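(* Let $\boldsymbol{\phi}=(\phi_I)_{I\subseteq\mathbb{N}}$ be an increasing family of online intersection tests. For $I\subseteq\mathbb{N}$ and $i\in\mathbb N$ define $\psi^I_i=\phi_{I\cap\{1,\ldots,i\}}$. Then $(\psi^I_i)_{i\in I}$ is an anytime-valid test for $H_I$ for all $I\subseteq\mathbb{N}$. Furthermore, let $\tilde{\boldsymbol{\phi}}=(\tilde\phi_I)_{I\subseteq\mathbb{N}}$ be defined by $$\tilde\phi_I=\inf\Big\{\sup_{i\in I}\psi_i^J:\ J\subseteq\mathbb{N},\ J\cap\{1,\ldots,\sup(I)\}=I\Big\}.$$ Then $\tilde\phi_S=\phi_S$ for all finite $S\subseteq\mathbb{N}$, and $\boldsymbol{d}^{\tilde{\boldsymbol{\phi}}}=\boldsymbol{d}^{\boldsymbol{\phi}}$.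
   Context: Setting. $\mathbb{N}=\{1,2,\ldots\}$, $\alpha\in(0,1)$ is fixed, $\Omega$ is equipped with a filtration $(\mathcal{F}_i)_{i\in\mathbb{N}_0}$ with $\mathcal{F}_0=\{\emptyset,\Omega\}$ and $\mathcal F_\infty=\sigma(\bigcup_i\mathcal F_i)$, and $\mathcal{P}$ is a nonempty set of probability distributions on $(\Omega,\mathcal F_\infty)$. Null hypotheses are subsets $H_1,H_2,\ldots\subseteq\mathcal{P}$; for $I\subseteq\mathbb{N}$, $H_I=\bigcap_{i\in I}H_i$ (with $H_\emptyset=\mathcal{P}$). Intersection test for $H_I$: a $\{0,1\}$-valued random variable $\phi_I$ with $\mathbb{P}(\phi_I=1)\le\alpha$ for all $\mathbb{P}\in H_I$. It is an online intersection test if it is $\mathcal{F}_{\sup(I)}$-measurable ($\mathcal F_\infty$ if $I$ is infinite). A family $(\phi_I)_{I\subseteq\mathbb{N}}$ is increasing if for all $i\in\mathbb{N}$, $I\subseteq\{1,\ldots,i\}$ and $K\subseteq\{k\in\mathbb{N}:k>i\}$ one has $\phi_I\le\phi_{I\cup K}$. Anytime-valid test for $H_I$: a family $(\psi_i)_{i\in I}$ of $\{0,1\}$-valued random variables such that $\psi_i$ is $\mathcal{F}_i$-measurable for each $i\in I$ and $\mathbb{P}(\exists i\in I:\psi_i=1)\le\alpha$ for all $\mathbb{P}\in H_I$. Closed procedure of a family $\boldsymbol\phi$: $\boldsymbol{d}^{\boldsymbol{\phi}}(S)=\inf\{|S\setminus I|: I\subseteq\mathbb{N},\ \phi_I=0\}$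 for finite $S\subseteq\mathbb{N}$. Conventions: $\sup(\emptyset)=0$ for index sets; $\{1,\ldots,\sup(I)\}=\mathbb{N}$ if $I$ is infinite and $=\emptyset$ if $I=\emptyset$; the supremum of $\{0,1\}$-valued quantities over an empty index set is $0$. *)

theory Defs
  imports "HOL-Probability.Probability" "HOL-Library.Extended_Nat"
begin

(* As in the locale filtration, the members of the filtration are values of type 'a measure of
   which only the space and the sigma-algebra matter. *)

definition sigma_infty :: "'a set \<Rightarrow> (nat \<Rightarrow> 'a measure) \<Rightarrow> 'a measure" where
  "sigma_infty \<Omega> F = sigma \<Omega> (\<Union>i. sets (F i))"

definition filtration_at :: "'a set \<Rightarrow> (nat \<Rightarrow> 'a measure) \<Rightarrow> enat \<Rightarrow> 'a measure" where
  "filtration_at \<Omega> F n = (case n of enat k \<Rightarrow> F k | \<infinity> \<Rightarrow> sigma_infty \<Omega> F)"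

(* Hypotheses are numbered 1, 2, ...; the value H 0 is irrelevant, and all index sets below are
   subsets of {1..}. *)

locale online_testing = filtration \<Omega> F
  for \<Omega> :: "'a set" and F :: "nat \<Rightarrow> 'a measure" +
  fixes \<P> :: "'a measure set" and H :: "nat \<Rightarrow> 'a measure set" and \<alpha> :: real
  assumes trivial_F0: "sets (F 0) = {{}, \<Omega>}"
    and nonempty_model: "\<P> \<noteq> {}"
    and prob_space_model: "P \<in> \<P> \<Longrightarrow> prob_space P"
    and sets_model: "P \<in> \<P> \<Longrightarrow> sets P = sets (sigma_infty \<Omega> F)"
    and hypothesis_subset: "i \<in> {1..} \<Longrightarrow> H i \<subseteq> \<P>"
    and level: "0 < \<alpha>" "\<alpha> < 1"

(* The intersection with the model makes the empty intersection equal to the whole model. *)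

definition intersection_hypothesis ::
  "'a measure set \<Rightarrow> (nat \<Rightarrow> 'a measure set) \<Rightarrow> nat set \<Rightarrow> 'a measure set" where
  "intersection_hypothesis \<P> H I = \<P> \<inter> (\<Inter>i\<in>I. H i)"

(* The supremum is taken in enat, so it is 0 for the empty set and infinite for infinite sets. *)

definition index_sup :: "nat set \<Rightarrow> enat" where
  "index_sup I = (SUP i\<in>I. enat i)"

definition initial_segment :: "enat \<Rightarrow> nat set" where
  "initial_segment n = {k. 1 \<le> k \<and> enat k \<le> n}"

(* Measurability into count_space {0, 1} includes that all values on \<Omega> lie in {0, 1}. *)

definition intersection_test ::
  "'a set \<Rightarrow> (nat \<Rightarrow> 'a measure) \<Rightarrow> 'a measure set \<Rightarrow> (nat \<Rightarrow> 'a measure set) \<Rightarrow> real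
    \<Rightarrow> nat set \<Rightarrow> ('a \<Rightarrow> nat) \<Rightarrow> bool" where
  "intersection_test \<Omega> F \<P> H \<alpha> I f \<longleftrightarrow>
    f \<in> measurable (sigma_infty \<Omega> F) (count_space {0, 1}) \<and>
    (\<forall>P\<in>intersection_hypothesis \<P> H I. measure P {\<omega> \<in> space P. f \<omega> = 1} \<le> \<alpha>)"

definition online_intersection_test ::
  "'a set \<Rightarrow> (nat \<Rightarrow> 'a measure) \<Rightarrow> 'a measure set \<Rightarrow> (nat \<Rightarrow> 'a measure set) \<Rightarrow> real
    \<Rightarrow> nat set \<Rightarrow> ('a \<Rightarrow> nat) \<Rightarrow> bool" where
  "online_intersection_test \<Omega> F \<P> H \<alpha> I f \<longleftrightarrow>
    intersection_test \<Omega> F \<P> H \<alpha> I f \<and>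
    f \<in> measurable (filtration_at \<Omega> F (index_sup I)) (count_space {0, 1})"

definition increasing_family :: "'a set \<Rightarrow> (nat set \<Rightarrow> 'a \<Rightarrow> nat) \<Rightarrow> bool" where
  "increasing_family \<Omega> \<phi> \<longleftrightarrow>
    (\<forall>i\<in>{1..}. \<forall>I K. I \<subseteq> {1..i} \<longrightarrow> K \<subseteq> {i<..} \<longrightarrow> (\<forall>\<omega>\<in>\<Omega>. \<phi> I \<omega> \<le> \<phi> (I \<union> K) \<omega>))"

definition anytime_valid_test ::
  "'a set \<Rightarrow> (nat \<Rightarrow> 'a measure) \<Rightarrow> 'a measure set \<Rightarrow> (nat \<Rightarrow> 'a measure set) \<Rightarrow> real
    \<Rightarrow> nat set \<Rightarrow> (nat \<Rightarrow> 'a \<Rightarrow> nat) \<Rightarrow> bool" where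
  "anytime_valid_test \<Omega> F \<P> H \<alpha> I \<psi> \<longleftrightarrow>
    (\<forall>i\<in>I. \<psi> i \<in> measurable (F i) (count_space {0, 1})) \<and>
    (\<forall>P\<in>intersection_hypothesis \<P> H I.
      measure P {\<omega> \<in> space P. \<exists>i\<in>I. \<psi> i \<omega> = 1} \<le> \<alpha>)"

(* Taken in enat so that the infimum over the empty set is infinite. *)

definition closed_procedure :: "(nat set \<Rightarrow> 'a \<Rightarrow> nat) \<Rightarrow> nat set \<Rightarrow> 'a \<Rightarrow> enat" where
  "closed_procedure \<phi> S \<omega> = (INF I\<in>{I. I \<subseteq> {1..} \<and> \<phi> I \<omega> = 0}. enat (card (S - I)))"

definition prefix_test :: "(nat set \<Rightarrow> 'a \<Rightarrow> nat) \<Rightarrow> nat set \<Rightarrow> nat \<Rightarrow> 'a \<Rightarrow> nat" where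
  "prefix_test \<phi> I i = \<phi> (I \<inter> {1..i})"

(* On type nat the supremum of the empty set is 0; the set of admissible J contains I, so the
   infimum is over a nonempty set. *)

definition prefix_closure :: "(nat set \<Rightarrow> 'a \<Rightarrow> nat) \<Rightarrow> nat set \<Rightarrow> 'a \<Rightarrow> nat" where
  "prefix_closure \<phi> I \<omega> =
    (INF J\<in>{J. J \<subseteq> {1..} \<and> J \<inter> initial_segment (index_sup I) = I}.
      SUP i\<in>I. prefix_test \<phi> J i \<omega>)"

end

theory Submission imports Defs begin

text \<open>Since the family is increasing, every prefix test is dominated by the test of the whole index
  set; this gives anytime validity and shows that the prefix closure lies below \<open>\<phi>\<close>, with equality
  on finite index sets. For the closed procedures, an infinite index set accepted by the prefix
  closure can be truncated beyond the maximum of \<open>S\<close> to a finite one that is accepted by \<open>\<phi>\<close> and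
  covers the same part of \<open>S\<close>. On the empty set both tests vanish, because \<open>F 0\<close> is trivial and
  \<open>\<alpha> < 1\<close>.\<close>

lemma index_sup_empty [simp]: "index_sup {} = 0"
  by (simp add: index_sup_def bot_enat_def)

lemma index_sup_eq_enat:
  assumes "m \<in> I" "\<And>i. i \<in> I \<Longrightarrow> i \<le> m"
  shows "index_sup I = enat m"
  unfolding index_sup_def by (rule cSup_eq_maximum) (use assms in auto)

lemma index_sup_infinite:
  assumes "infinite I"
  shows "index_sup I = \<infinity>"
proof -
  \<comment> \<open>On \<open>enat\<close>, \<open>Sup\<close> is defined by cases on finiteness of
    the set, so it suffices that the injection \<open>enat\<close> preserves infinitude.\<close>
  have "infinite (enat ` I)"
    using assms finite_imageD[of enat I] by (auto simp: inj_on_def)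
  then show ?thesis
    using assms unfolding index_sup_def Sup_enat_def by auto
qed

lemma initial_segment_enat: "initial_segment (enat m) = {1..m}"
  by (auto simp: initial_segment_def)

lemma initial_segment_infinity: "initial_segment \<infinity> = {1..}"
  by (auto simp: initial_segment_def)

text \<open>Cutting \<open>I\<close> at \<open>i\<close> splits it into a part inside
  \<open>{1..i}\<close> and a part inside \<open>{i<..}\<close>, which is the shape that
  \<open>increasing_family\<close> compares.\<close>

lemma prefix_test_le:
  assumes "increasing_family \<Omega> \<phi>" "I \<subseteq> {1..}" "1 \<le> i" "\<omega> \<in> \<Omega>"
  shows "prefix_test \<phi> I i \<omega> \<le> \<phi> I \<omega>"
proof -
  have "\<phi> (I \<inter> {1..i}) \<omega> \<le> \<phi> (I \<inter> {1..i} \<union> I \<inter> {i<..}) \<omega>"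
    using assms(1,3,4) unfolding increasing_family_def by auto
  moreover have "I \<inter> {1..i} \<union> I \<inter> {i<..} = I"
    using assms(2) by auto
  ultimately show ?thesis
    by (simp add: prefix_test_def)
qed

lemma prefix_closure_empty [simp]: "prefix_closure \<phi> {} \<omega> = 0"
proof -
  have "{} \<in> {J. J \<subseteq> {1..} \<and> J \<inter> initial_segment (index_sup {}) = {}}"
    by simp
  then show ?thesis
    using cINF_const[of "{J. J \<subseteq> {1..} \<and> J \<inter> initial_segment (index_sup {}) = {}}" "0::nat"]
    unfolding prefix_closure_def image_empty Sup_nat_empty by blast
qed

text \<open>Every admissible \<open>J\<close> agrees with \<open>S\<close> up to
  \<open>Max S\<close>, so its prefix tests at indices in \<open>S\<close> are those of
  \<open>S\<close>. They are bounded by \<phi> at \<open>S\<close>, and the bound is attained at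
  \<open>Max S\<close>, so the infimum is over a constant.\<close>

lemma prefix_closure_finite:
  assumes "increasing_family \<Omega> \<phi>" "S \<subseteq> {1..}" "finite S" "S \<noteq> {}" "\<omega> \<in> \<Omega>"
  shows "prefix_closure \<phi> S \<omega> = \<phi> S \<omega>"
proof -
  define m where "m = Max S"
  have m: "m \<in> S" "\<And>i. i \<in> S \<Longrightarrow> i \<le> m"
    using assms(3,4) by (auto simp: m_def)
  have S: "S \<inter> {1..m} = S"
    using m(2) assms(2) by auto
  have "(SUP i\<in>S. prefix_test \<phi> J i \<omega>) = \<phi> S \<omega>" if J: "J \<inter> {1..m} = S" for J
  proof (rule cSup_eq_maximum)
    show "\<phi> S \<omega> \<in> (\<lambda>i. prefix_test \<phi> J i \<omega>) ` S"
      using m(1) J by (auto simp: prefix_test_def)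
    fix x assume "x \<in> (\<lambda>i. prefix_test \<phi> J i \<omega>) ` S"
    then obtain i where i: "i \<in> S" "x = prefix_test \<phi> J i \<omega>"
      by auto
    have "J \<inter> {1..i} = S \<inter> {1..i}"
      using J m(2)[OF i(1)] by auto
    then have "x = prefix_test \<phi> S i \<omega>"
      using i(2) by (simp add: prefix_test_def)
    then show "x \<le> \<phi> S \<omega>"
      using prefix_test_le[OF assms(1,2) _ assms(5)] i(1) assms(2) by auto
  qed
  then have "(INF J\<in>{J. J \<subseteq> {1..} \<and> J \<inter> {1..m} = S}. SUP i\<in>S. prefix_test \<phi> J i \<omega>)
      = (INF J\<in>{J. J \<subseteq> {1..} \<and> J \<inter> {1..m} = S}. \<phi> S \<omega>)"
    by (intro INF_cong refl) blast
  also have "\<dots> = \<phi> S \<omega>"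
    \<comment> \<open>The set \<open>S\<close> is itself admissible, so the infimum is over a
      nonempty set.\<close>
    by (rule cINF_const) (use S assms(2) in blast)
  finally have *: "(INF J\<in>{J. J \<subseteq> {1..} \<and> J \<inter> {1..m} = S}. SUP i\<in>S. prefix_test \<phi> J i \<omega>)
      = \<phi> S \<omega>" .
  have "index_sup S = enat m"
    using m by (rule index_sup_eq_enat)
  then have "initial_segment (index_sup S) = {1..m}"
    by (simp only: initial_segment_enat)
  then show ?thesis
    unfolding prefix_closure_def by (simp only: *)
qed

text \<open>The initial segment is now all of \<open>{1..}\<close>, which leaves
  \<open>J = I\<close> as the only admissible set.\<close>

lemma prefix_closure_infinite:
  assumes "I \<subseteq> {1..}" "infinite I"
  shows "prefix_closure \<phi> I \<omega> = (SUP i\<in>I. prefix_test \<phi> I i \<omega>)"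
proof -
  have "{J. J \<subseteq> {1..} \<and> J \<inter> initial_segment (index_sup I) = I} = {I}"
    using assms(1) by (auto simp: index_sup_infinite[OF assms(2)] initial_segment_infinity)
  then show ?thesis
    by (simp add: prefix_closure_def)
qed

lemma prefix_test_le_prefix_closure:
  assumes "increasing_family \<Omega> \<phi>" "I \<subseteq> {1..}" "infinite I" "i \<in> I" "\<omega> \<in> \<Omega>"
  shows "prefix_test \<phi> I i \<omega> \<le> prefix_closure \<phi> I \<omega>"
  unfolding prefix_closure_infinite[OF assms(2,3)]
proof (rule cSUP_upper[OF assms(4)])
  \<comment> \<open>Suprema on \<open>nat\<close> are only conditionally complete; the test of the
    whole set \<open>I\<close> supplies the bound.\<close>
  show "bdd_above ((\<lambda>i. prefix_test \<phi> I i \<omega>) ` I)"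
    using prefix_test_le[OF assms(1,2) _ assms(5)] assms(2)
    by (intro bdd_aboveI2[where M = "\<phi> I \<omega>"]) fastforce
qed

text \<open>Only an inequality is claimed, since for infinite \<open>I\<close> the whole test may
  reject although every prefix test accepts.\<close>

lemma prefix_closure_le:
  assumes "increasing_family \<Omega> \<phi>" "I \<subseteq> {1..}" "I \<noteq> {}" "\<omega> \<in> \<Omega>"
  shows "prefix_closure \<phi> I \<omega> \<le> \<phi> I \<omega>"
proof (cases "finite I")
  case True
  then show ?thesis
    using prefix_closure_finite[OF assms(1,2) _ assms(3,4)] by simp
next
  case False
  show ?thesis
    unfolding prefix_closure_infinite[OF assms(2) False]
    using prefix_test_le[OF assms(1,2) _ assms(4)] assms(2)
    by (intro cSUP_least[OF assms(3)]) auto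
qed

lemma closed_procedure_prefix_closure:
  assumes inc: "increasing_family \<Omega> \<phi>" and \<omega>: "\<omega> \<in> \<Omega>" and empty: "\<phi> {} \<omega> = 0"
    and S: "finite S"
  shows "closed_procedure (prefix_closure \<phi>) S \<omega> = closed_procedure \<phi> S \<omega>"
proof (rule antisym)
  have "prefix_closure \<phi> I \<omega> = 0" if "I \<subseteq> {1..}" "\<phi> I \<omega> = 0" for I
    using prefix_closure_le[OF inc that(1) _ \<omega>] that(2)
    by (cases "I = {}") simp_all
  \<comment> \<open>Each set accepted by \<phi> is accepted by the closure, and an infimum over more
    sets is smaller.\<close>
  then show "closed_procedure (prefix_closure \<phi>) S \<omega> \<le> closed_procedure \<phi> S \<omega>"
    unfolding closed_procedure_def by (intro INF_superset_mono) blast+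
next
  show "closed_procedure \<phi> S \<omega> \<le> closed_procedure (prefix_closure \<phi>) S \<omega>"
    unfolding closed_procedure_def
  proof (rule INF_mono)
    fix I assume "I \<in> {I. I \<subseteq> {1..} \<and> prefix_closure \<phi> I \<omega> = 0}"
    then have I: "I \<subseteq> {1..}" "prefix_closure \<phi> I \<omega> = 0"
      by auto
    show "\<exists>I'\<in>{I. I \<subseteq> {1..} \<and> \<phi> I \<omega> = 0}. enat (card (S - I')) \<le> enat (card (S - I))"
    proof (cases "finite I")
      case True
      then have "\<phi> I \<omega> = 0"
        using prefix_closure_finite[OF inc I(1) True _ \<omega>] I(2) empty by (cases "I = {}") simp_all
      then show ?thesis
        using I(1) by blast
    next
      case False
      from S obtain k where k: "\<forall>s\<in>S. s \<le> k"
        using finite_nat_set_iff_bounded_le by blast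
      \<comment> \<open>The cut \<open>i\<close> exceeds every element of \<open>S\<close>, so
        truncation loses nothing of \<open>S\<close>. It is taken in \<open>I\<close> because the
        supremum in the closure runs over \<open>I\<close> only.\<close>
      obtain i where i: "i \<in> I" "k < i"
        using False by (auto simp: infinite_nat_iff_unbounded)
      have "\<phi> (I \<inter> {1..i}) \<omega> = 0"
        using prefix_test_le_prefix_closure[OF inc I(1) False i(1) \<omega>] I(2)
        by (simp add: prefix_test_def)
      moreover have "S - I \<inter> {1..i} = S - I"
      proof -
        have "s \<in> {1..i}" if "s \<in> S" "s \<in> I" for s
          using that I(1) i(2) k by (meson atLeastAtMost_iff atLeast_iff less_imp_le le_trans subsetD)
        then show ?thesis
          by blast
      qed
      moreover have "I \<inter> {1..i} \<subseteq> {1..}"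
        using I(1) by blast
      ultimately show ?thesis
        by (metis (mono_tags, lifting) mem_Collect_eq order_refl)
    qed
  qed
qed

context online_testing
begin

lemma space_model:
  assumes "P \<in> \<P>"
  shows "space P = \<Omega>"
  using sets_eq_imp_space_eq[OF sets_model[OF assms]]
  by (simp add: sigma_infty_def space_measure_of_conv)

lemma test_empty:
  assumes "online_intersection_test \<Omega> F \<P> H \<alpha> {} f" "\<omega> \<in> \<Omega>"
  shows "f \<omega> = 0"
proof -
  have f: "f \<in> measurable (F 0) (count_space {0, 1})"
    using assms(1) by (simp add: online_intersection_test_def filtration_at_def zero_enat_def)
  have "f -` {1} \<inter> space (F 0) \<in> sets (F 0)"
    using f by (rule measurable_sets) auto
  then have cases: "f -` {1} \<inter> \<Omega> = {} \<or> f -` {1} \<inter> \<Omega> = \<Omega>"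
    by (simp add: trivial_F0 space_F)
  obtain P where P: "P \<in> \<P>"
    using nonempty_model by auto
  interpret P: prob_space P
    by (rule prob_space_model[OF P])
  \<comment> \<open>The intersection hypothesis of the empty set is the whole model, so the level
    bound applies to this arbitrary \<open>P\<close>.\<close>
  have "measure P {\<omega> \<in> space P. f \<omega> = 1} \<le> \<alpha>"
    using assms(1) P
    by (auto simp: online_intersection_test_def intersection_test_def intersection_hypothesis_def)
  moreover have "{\<omega> \<in> space P. f \<omega> = 1} = f -` {1} \<inter> \<Omega>"
    by (auto simp: space_model[OF P])
  ultimately have "f -` {1} \<inter> \<Omega> \<noteq> \<Omega>"
    using P.prob_space level(2) by (auto simp: space_model[OF P])
  with cases assms(2) have "f \<omega> \<noteq> 1"
    by auto
  moreover have "f \<omega> \<in> {0, 1}"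
    using measurable_space[OF f] assms(2) by (simp add: space_F)
  ultimately show ?thesis
    by auto
qed

text \<open>A rejection by any prefix test forces \<phi> at \<open>I\<close> to reject, so a single
  level-\<alpha> event covers all times and no union bound over \<open>i\<close> arises.\<close>

lemma anytime_valid_prefix_test:
  assumes tests: "\<And>I. I \<subseteq> {1..} \<Longrightarrow> online_intersection_test \<Omega> F \<P> H \<alpha> I (\<phi> I)"
    and inc: "increasing_family \<Omega> \<phi>" and I: "I \<subseteq> {1..}"
  shows "anytime_valid_test \<Omega> F \<P> H \<alpha> I (prefix_test \<phi> I)"
  unfolding anytime_valid_test_def
proof (intro conjI ballI)
  fix i assume i: "i \<in> I"
  \<comment> \<open>Since \<open>i\<close> lies in \<open>I\<close>, the truncated set has maximum
    exactly \<open>i\<close>, which yields measurability with respect to \<open>F i\<close>.\<close>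
  then have "index_sup (I \<inter> {1..i}) = enat i"
    using I by (intro index_sup_eq_enat) auto
  then show "prefix_test \<phi> I i \<in> measurable (F i) (count_space {0, 1})"
    using tests[of "I \<inter> {1..i}", OF le_infI1[OF I]]
    by (simp add: online_intersection_test_def filtration_at_def prefix_test_def)
next
  fix P assume P: "P \<in> intersection_hypothesis \<P> H I"
  then have P': "P \<in> \<P>"
    by (simp add: intersection_hypothesis_def)
  interpret P: prob_space P
    by (rule prob_space_model[OF P'])
  have test: "\<phi> I \<in> measurable (sigma_infty \<Omega> F) (count_space {0, 1})"
    "measure P {\<omega> \<in> space P. \<phi> I \<omega> = 1} \<le> \<alpha>"
    using tests[OF I] P by (auto simp: online_intersection_test_def intersection_test_def)
  have meas: "\<phi> I \<in> measurable P (count_space {0, 1})"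
    using test(1) measurable_cong_sets[OF sets_model[OF P'] refl] by blast
  have "\<phi> I -` {1} \<inter> space P \<in> sets P"
    using meas by (rule measurable_sets) auto
  moreover have "\<phi> I -` {1} \<inter> space P = {\<omega> \<in> space P. \<phi> I \<omega> = 1}"
    by auto
  \<comment> \<open>Monotonicity of the measure requires the larger event to be measurable.\<close>
  ultimately have event: "{\<omega> \<in> space P. \<phi> I \<omega> = 1} \<in> sets P"
    by simp
  have "\<phi> I \<omega> = 1" if "\<omega> \<in> space P" "i \<in> I" "prefix_test \<phi> I i \<omega> = 1" for \<omega> i
  proof -
    have "1 \<le> \<phi> I \<omega>"
      using prefix_test_le[OF inc I, of i \<omega>] that I by (auto simp: space_model[OF P'])
    moreover have "\<phi> I \<omega> \<in> {0, 1}"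
      using measurable_space[OF meas that(1)] by simp
    ultimately show ?thesis
      by auto
  qed
  then have "measure P {\<omega> \<in> space P. \<exists>i\<in>I. prefix_test \<phi> I i \<omega> = 1}
      \<le> measure P {\<omega> \<in> space P. \<phi> I \<omega> = 1}"
    by (intro P.finite_measure_mono event) auto
  then show "measure P {\<omega> \<in> space P. \<exists>i\<in>I. prefix_test \<phi> I i \<omega> = 1} \<le> \<alpha>"
    using test(2) by linarith
qed

end

theorem theorem2p3:
  fixes \<Omega> :: "'a set" and F :: "nat \<Rightarrow> 'a measure"
    and \<P> :: "'a measure set" and H :: "nat \<Rightarrow> 'a measure set" and \<alpha> :: real
    and \<phi> :: "nat set \<Rightarrow> 'a \<Rightarrow> nat"
  assumes setting: "online_testing \<Omega> F \<P> H \<alpha>"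
    and tests: "\<And>I. I \<subseteq> {1..} \<Longrightarrow> online_intersection_test \<Omega> F \<P> H \<alpha> I (\<phi> I)"
    and increasing: "increasing_family \<Omega> \<phi>"
  shows "(\<forall>I\<subseteq>{1..}. anytime_valid_test \<Omega> F \<P> H \<alpha> I (prefix_test \<phi> I)) \<and>
    (\<forall>S\<subseteq>{1..}. finite S \<longrightarrow> (\<forall>\<omega>\<in>\<Omega>. prefix_closure \<phi> S \<omega> = \<phi> S \<omega>)) \<and>
    (\<forall>S\<subseteq>{1..}. finite S \<longrightarrow>
      (\<forall>\<omega>\<in>\<Omega>. closed_procedure (prefix_closure \<phi>) S \<omega> = closed_procedure \<phi> S \<omega>))"
proof -
  interpret online_testing \<Omega> F \<P> H \<alpha>
    by (rule setting)
  have empty: "\<phi> {} \<omega> = 0" if "\<omega> \<in> \<Omega>" for \<omega>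
    by (rule test_empty[OF tests that]) simp
  have "anytime_valid_test \<Omega> F \<P> H \<alpha> I (prefix_test \<phi> I)" if "I \<subseteq> {1..}" for I
    using tests increasing that by (rule anytime_valid_prefix_test)
  moreover have "prefix_closure \<phi> S \<omega> = \<phi> S \<omega>" if "S \<subseteq> {1..}" "finite S" "\<omega> \<in> \<Omega>" for S \<omega>
    \<comment> \<open>The empty set has no maximum to stop at; there both sides are 0.\<close>
    using prefix_closure_finite[OF increasing that(1,2) _ that(3)] empty[OF that(3)]
    by (cases "S = {}") auto
  moreover have "closed_procedure (prefix_closure \<phi>) S \<omega> = closed_procedure \<phi> S \<omega>"
    if "finite S" "\<omega> \<in> \<Omega>" for S \<omega>
    using increasing that(2) empty[OF that(2)] that(1) by (rule closed_procedure_prefix_closure)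
  ultimately show ?thesis
    by blast
qed

end
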